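(* Let $d\ge 2$, let $H$ be a Hermitian $d\times d$ matrix, and let $\rho_\beta=e^{-\beta H}/\mathrm{tr}(e^{-\beta H})$ be the thermal statistical model of the $d$-level system with Hamiltonian $H$, parametrized by the inverse temperature $\beta$. Then every semiclassical measurement scheme is efficient with respect to the disturbance measure $\mathfrak D^{(\Delta)}_\beta$.
   Context: Measurement schemes: $\mathscr M$ is given by a POVM $\{\Pi_x\}_{x\in\mathcal X}$ on $\mathbb C^d$ with discrete sample space $\mathcal X$ ($\Pi_x$ Hermitian positive semidefinite, $\sum_{x}\Pi_x=\mathbb I_d$), implemented by the Lüders instrument: outcome $x$ has probability $p_{x,\beta}=\mathrm{tr}(\rho_\beta\Pi_x)$ and the conditional state is $\rho_{\beta|x}=\sqrt{\Pi_x}\,\rho_\beta\sqrt{\Pi_x}/p_{x,\beta}$ (outcomes with $\Pi_x=0$ never occur and are ignored). Fisher information: $\mathcal F_\beta(\rho_\beta,\mathscr M)=\sum_{x} p_{x,\beta}\,(\partial_\beta\log p_{x,\beta})^2$. Quantum Fisher information: for a differentiable family of density matrices $\rho_\beta$, $\mathcal F^{(Q)}_\beta(\rho_\beta)=\mathrm{tr}(\rho_\beta L^2)$, where the symmetric logarithmic derivative $L$ is a Hermitian matrix with $\partial_\beta\rho_\beta=\tfrac12(\rho_\beta L+L\rho_\beta)$. $\Delta$-disturbance (average information loss): $\mathfrak D^{(\Delta)}_\beta(\mathscr M)=\mathcal F^{(Q)}_\beta(\rho_\beta)-\sum_x p_{x,\beta}\,\mathcal F^{(Q)}_\beta(\rho_{\beta|x})$,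 where $\mathcal F^{(Q)}_\beta(\rho_{\beta|x})$ is the quantum Fisher information of the family $\beta\mapsto\rho_{\beta|x}$. Semiclassical: all POVM elements can be diagonalized simultaneously together with the statistical model, i.e. $[\Pi_x,\rho_\beta]=[\Pi_x,\Pi_{x'}]=0$ for all $x,x'\in\mathcal X$ and all $\beta$. Efficient with respect to $\mathfrak D^{(\Delta)}_\beta$: $\mathscr M$ minimizes the disturbance at fixed extracted information, i.e. $\mathfrak D^{(\Delta)}_\beta(\mathscr M)\le\mathfrak D^{(\Delta)}_\beta(\mathscr M')$ for every measurement scheme $\mathscr M'$ (POVM implemented by its Lüders instrument) with $\mathcal F_\beta(\rho_\beta,\mathscr M')=\mathcal F_\beta(\rho_\beta,\mathscr M)$. *)

theory Defs
  imports "HOL-Analysis.Analysis"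
begin

type_synonym 'n cmat = "complex ^ 'n ^ 'n"

definition hermitian :: "'n::finite cmat \<Rightarrow> bool" where
  "hermitian A \<longleftrightarrow> (\<forall>i j. A $ i $ j = cnj (A $ j $ i))"

text \<open>The quadratic form of a Hermitian matrix is real, so taking its real part loses nothing.\<close>

definition psd :: "'n::finite cmat \<Rightarrow> bool" where
  "psd A \<longleftrightarrow> hermitian A \<and> (\<forall>v. 0 \<le> Re (\<Sum>i\<in>UNIV. cnj (v $ i) * (A *v v) $ i))"

text \<open>The positive semidefinite square root of a positive semidefinite matrix is unique.\<close>

definition psd_sqrt :: "'n::finite cmat \<Rightarrow> 'n cmat" where
  "psd_sqrt A = (SOME B. psd B \<and> B ** B = A)"

text \<open>The library's \<open>*\<close> (hence its power) on type \<open>complex ^ 'n ^ 'n\<close> acts entrywise, so the matrix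
  power and the exponential series are written with \<open>**\<close>.\<close>

definition matrix_power :: "'n::finite cmat \<Rightarrow> nat \<Rightarrow> 'n cmat" where
  "matrix_power A k = (((**) A) ^^ k) (mat 1)"

definition matrix_exp :: "'n::finite cmat \<Rightarrow> 'n cmat" where
  "matrix_exp A = (\<Sum>k. matrix_power A k /\<^sub>R fact k)"

text \<open>All traces whose real part is taken below are real: they are traces of Hermitian matrices
  or of products of two Hermitian matrices.\<close>

definition thermal_state :: "'n::finite cmat \<Rightarrow> real \<Rightarrow> 'n cmat" where
  "thermal_state H \<beta> =
     matrix_exp ((- \<beta>) *\<^sub>R H) /\<^sub>R Re (trace (matrix_exp ((- \<beta>) *\<^sub>R H)))"

definition povm :: "'x set \<Rightarrow> ('x \<Rightarrow> 'n::finite cmat) \<Rightarrow> bool" where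
  "povm X E \<longleftrightarrow> countable X \<and> (\<forall>x\<in>X. psd (E x)) \<and> (E has_sum mat 1) X"

definition outcome_prob :: "(real \<Rightarrow> 'n::finite cmat) \<Rightarrow> 'n cmat \<Rightarrow> real \<Rightarrow> real" where
  "outcome_prob \<rho> P \<beta> = Re (trace (\<rho> \<beta> ** P))"

definition conditional_state ::
    "(real \<Rightarrow> 'n::finite cmat) \<Rightarrow> 'n cmat \<Rightarrow> real \<Rightarrow> 'n cmat" where
  "conditional_state \<rho> P \<beta> = (psd_sqrt P ** \<rho> \<beta> ** psd_sqrt P) /\<^sub>R outcome_prob \<rho> P \<beta>"

text \<open>In the sums over outcomes below, an outcome with \<open>E x = 0\<close> contributes \<open>0\<close> because of
  the factor \<^const>\<open>outcome_prob\<close>. For thermal states the sums converge also when the outcome set is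
  infinite: their terms are nonnegative and the partial sums are bounded by the quantum Fisher
  information of the model.\<close>

definition fisher_information ::
    "(real \<Rightarrow> 'n::finite cmat) \<Rightarrow> 'x set \<Rightarrow> ('x \<Rightarrow> 'n cmat) \<Rightarrow> real \<Rightarrow> real" where
  "fisher_information \<rho> X E \<beta> =
     (\<Sum>\<^sub>\<infinity>x\<in>X. outcome_prob \<rho> (E x) \<beta> * (deriv (\<lambda>b. ln (outcome_prob \<rho> (E x) b)) \<beta>)\<^sup>2)"

definition is_sld :: "(real \<Rightarrow> 'n::finite cmat) \<Rightarrow> real \<Rightarrow> 'n cmat \<Rightarrow> bool" where
  "is_sld \<rho> \<beta> L \<longleftrightarrow> hermitian L \<and>
     (\<rho> has_vector_derivative (1/2) *\<^sub>R (\<rho> \<beta> ** L + L ** \<rho> \<beta>)) (at \<beta>)"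

text \<open>The symmetric logarithmic derivative is not unique if \<open>\<rho> \<beta>\<close> is singular, but two of them
  have the same product with \<open>\<rho> \<beta>\<close>, so the value does not depend on the choice.\<close>

definition quantum_fisher_information :: "(real \<Rightarrow> 'n::finite cmat) \<Rightarrow> real \<Rightarrow> real" where
  "quantum_fisher_information \<rho> \<beta> =
     (let L = (SOME L. is_sld \<rho> \<beta> L) in Re (trace (\<rho> \<beta> ** (L ** L))))"

definition disturbance ::
    "(real \<Rightarrow> 'n::finite cmat) \<Rightarrow> 'x set \<Rightarrow> ('x \<Rightarrow> 'n cmat) \<Rightarrow> real \<Rightarrow> real" where
  "disturbance \<rho> X E \<beta> =
     quantum_fisher_information \<rho> \<beta> -
     (\<Sum>\<^sub>\<infinity>x\<in>X. outcome_prob \<rho> (E x) \<beta> *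
        quantum_fisher_information (conditional_state \<rho> (E x)) \<beta>)"

definition semiclassical ::
    "(real \<Rightarrow> 'n::finite cmat) \<Rightarrow> 'x set \<Rightarrow> ('x \<Rightarrow> 'n cmat) \<Rightarrow> bool" where
  "semiclassical \<rho> X E \<longleftrightarrow>
     (\<forall>x\<in>X. \<forall>\<beta>. E x ** \<rho> \<beta> = \<rho> \<beta> ** E x) \<and>
     (\<forall>x\<in>X. \<forall>x'\<in>X. E x ** E x' = E x' ** E x)"

text \<open>The competing schemes may have any countable outcome set; the type of their outcome labels
  is passed as an argument because it cannot be quantified inside the definition.\<close>

definition efficient ::
    "'y itself \<Rightarrow> (real \<Rightarrow> 'n::finite cmat) \<Rightarrow> 'x set \<Rightarrow> ('x \<Rightarrow> 'n cmat) \<Rightarrow> real \<Rightarrow> bool" where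
  "efficient (_ :: 'y itself) \<rho> X E \<beta> \<longleftrightarrow>
     (\<forall>(Y :: 'y set) E'. povm Y E' \<and>
        fisher_information \<rho> Y E' \<beta> = fisher_information \<rho> X E \<beta> \<longrightarrow>
        disturbance \<rho> X E \<beta> \<le> disturbance \<rho> Y E' \<beta>)"

end

theory Submission
  imports Defs
begin

text \<open>Let \<open>L\<close> be the symmetric logarithmic derivative of the model and \<open>\<sigma> = K ** \<rho> ** K\<close>, with
  \<open>K\<close> the root of \<open>E x\<close>, the unnormalized conditional state. Adding \<open>p' / p\<close> to the symmetric
  logarithmic derivative of \<open>\<sigma> / p\<close> gives a Hermitian \<open>M\<close> that solves
  \<open>\<sigma>' = (\<sigma> ** M + M ** \<sigma>) / 2\<close>, and the Fisher information contributed by the outcome plus the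
  average quantum Fisher information kept by it is the trace of \<open>\<sigma> ** M ** M\<close>. This is at most the trace of
  \<open>L ** \<rho> ** L ** E x\<close>, with equality if \<open>E x\<close> commutes with \<open>L\<close>. Summing over the outcomes, the
  disturbance is at least the extracted Fisher information for every scheme. For thermal states
  \<open>L\<close> commutes with \<open>\<rho>\<close>, so that the elements of a semiclassical scheme commute with \<open>L\<close>
  and equality holds.\<close>

section \<open>Conjugate transposes and real traces\<close>

definition dagger :: "'n::finite cmat \<Rightarrow> 'n cmat" where
  "dagger A = (\<chi> i j. cnj (A $ j $ i))"

text \<open>Only the real part is kept, so that the trace becomes a real-linear functional tied to
  the real inner product of matrices.\<close>

definition rtr :: "'n::finite cmat \<Rightarrow> real" where
  "rtr A = Re (trace A)"

text \<open>Source of the distributivity rules for \<open>**\<close>, of its exchange with finite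
  sums, and of the derivatives of products with a constant matrix.\<close>

lemma bounded_bilinear_matrix_mult: "bounded_bilinear ((**) :: 'n::finite cmat \<Rightarrow> 'n cmat \<Rightarrow> 'n cmat)"
  unfolding bilinear_conv_bounded_bilinear[symmetric] bilinear_def
  by (auto intro!: linearI simp: matrix_matrix_mult_def vec_eq_iff distrib_left distrib_right
      sum.distrib scaleR_sum_right)

lemmas mm_distribs =
  bounded_bilinear.add_left[OF bounded_bilinear_matrix_mult]
  bounded_bilinear.add_right[OF bounded_bilinear_matrix_mult]
  bounded_bilinear.diff_left[OF bounded_bilinear_matrix_mult]
  bounded_bilinear.diff_right[OF bounded_bilinear_matrix_mult]
  bounded_bilinear.minus_left[OF bounded_bilinear_matrix_mult]
  bounded_bilinear.minus_right[OF bounded_bilinear_matrix_mult]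
  bounded_bilinear.scaleR_left[OF bounded_bilinear_matrix_mult]
  bounded_bilinear.scaleR_right[OF bounded_bilinear_matrix_mult]

lemmas mm_zero =
  bounded_bilinear.zero_left[OF bounded_bilinear_matrix_mult]
  bounded_bilinear.zero_right[OF bounded_bilinear_matrix_mult]

lemma linear_dagger: "linear dagger"
  by (auto intro!: linearI simp: dagger_def vec_eq_iff)

lemmas dagger_distribs = linear_add[OF linear_dagger] linear_diff[OF linear_dagger]
  linear_scale[OF linear_dagger]

lemma dagger_mult: "dagger (A ** B) = dagger B ** dagger A"
  by (simp add: dagger_def matrix_matrix_mult_def vec_eq_iff mult.commute)

lemma dagger_dagger [simp]: "dagger (dagger A) = A"
  by (simp add: dagger_def vec_eq_iff)

lemma hermitian_iff_dagger: "hermitian A \<longleftrightarrow> dagger A = A"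
  unfolding hermitian_def dagger_def vec_eq_iff vec_lambda_beta by metis

lemma linear_rtr: "linear rtr"
  by (auto intro!: linearI simp: rtr_def trace_def sum.distrib sum_distrib_left)

lemmas rtr_distribs = linear_add[OF linear_rtr] linear_diff[OF linear_rtr]
  linear_scale[OF linear_rtr] linear_0[OF linear_rtr]

lemma rtr_commute: "rtr (A ** B) = rtr (B ** A)"
  by (simp only: rtr_def trace_mul_sym[of A B])

text \<open>The Euclidean inner product on matrices is the real part of the Hilbert-Schmidt product.
  Hence Gram traces are nonnegative and definite, and linear maps on matrices can be treated by
  orthogonality.\<close>

lemma inner_eq_rtr: "A \<bullet> B = rtr (dagger A ** B)"
proof -
  have "A \<bullet> B = (\<Sum>i\<in>UNIV. \<Sum>j\<in>UNIV. Re (cnj (A $ i $ j) * B $ i $ j))"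
    by (simp add: inner_vec_def inner_complex_def)
  also have "\<dots> = (\<Sum>j\<in>UNIV. \<Sum>i\<in>UNIV. Re (cnj (A $ i $ j) * B $ i $ j))"
    by (rule sum.swap)
  finally show ?thesis
    by (simp add: rtr_def trace_def dagger_def matrix_matrix_mult_def)
qed

lemma rtr_gram_nonneg: "0 \<le> rtr (dagger A ** A)"
  by (metis inner_eq_rtr inner_ge_zero)

lemma rtr_gram_eq_0_iff: "rtr (dagger A ** A) = 0 \<longleftrightarrow> A = 0"
  by (metis inner_eq_rtr inner_eq_zero_iff)

section \<open>Spectral resolution of Hermitian matrices\<close>

text \<open>Rayleigh quotient argument: \<open>x \<bullet> T x\<close> attains its maximum on the
  compact unit sphere of \<open>W\<close>, and a maximizer is an eigenvector. Working over the reals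
  makes the eigenvalue real from the start.\<close>

lemma selfadjoint_eigenvector_exists:
  fixes T :: "'a::euclidean_space \<Rightarrow> 'a"
  assumes lin: "linear T" and sa: "\<And>x y. T x \<bullet> y = x \<bullet> T y"
    and W: "subspace W" "\<And>x. x \<in> W \<Longrightarrow> T x \<in> W" "W \<noteq> {0}"
  shows "\<exists>v \<mu>. v \<in> W \<and> norm v = 1 \<and> T v = \<mu> *\<^sub>R v"
proof -
  obtain w where w: "w \<in> W" "w \<noteq> 0"
    using W(3) subspace_0[OF W(1)] by blast
  have "W \<inter> sphere 0 1 \<noteq> {}"
  proof -
    have "w /\<^sub>R norm w \<in> W \<inter> sphere 0 1"
      using w W(1) by (auto simp: subspace_scale)
    then show ?thesis by blast
  qed
  moreover have "compact (W \<inter> sphere 0 1)"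
    by (simp add: W(1) closed_Int_compact closed_subspace)
  moreover have "continuous_on (W \<inter> sphere 0 1) (\<lambda>x. x \<bullet> T x)"
    by (intro continuous_intros linear_continuous_on lin[unfolded linear_conv_bounded_linear])
  ultimately obtain v where "v \<in> W \<inter> sphere 0 1"
    and "\<forall>x\<in>W \<inter> sphere 0 1. x \<bullet> T x \<le> v \<bullet> T v"
    using continuous_attains_sup[of "W \<inter> sphere 0 1" "\<lambda>x. x \<bullet> T x"] by blast
  then have v: "v \<in> W" "norm v = 1"
    and max: "\<And>x. x \<in> W \<Longrightarrow> norm x = 1 \<Longrightarrow> x \<bullet> T x \<le> v \<bullet> T v"
    by auto
  define \<mu> where "\<mu> = v \<bullet> T v"
  have bound: "x \<bullet> T x \<le> \<mu> * (x \<bullet> x)" if "x \<in> W" for x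
  proof (cases "x = 0")
    case False
    have "(x /\<^sub>R norm x) \<bullet> T (x /\<^sub>R norm x) \<le> \<mu>"
      unfolding \<mu>_def using False that W(1) by (intro max) (auto simp: subspace_scale)
    then have "(x \<bullet> T x) / (norm x)\<^sup>2 \<le> \<mu>"
      by (simp add: linear_scale[OF lin] power2_eq_square divide_inverse mult_ac)
    then show ?thesis
      using False by (simp add: power2_norm_eq_inner[symmetric] divide_le_eq split: if_splits)
  qed (simp add: linear_0[OF lin])
  \<comment> \<open>The residual of the eigenvalue equation, orthogonal to \<open>v\<close>. It is
    shown to vanish by moving from \<open>v\<close> in its direction.\<close>
  define u where "u = T v - \<mu> *\<^sub>R v"
  have uW: "u \<in> W"
    unfolding u_def using v W by (intro subspace_diff subspace_scale) auto
  have vv: "v \<bullet> v = 1"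
    using v(2) by (simp add: norm_eq_1)
  have uv: "u \<bullet> v = 0"
    by (simp add: u_def inner_diff_left vv \<mu>_def inner_commute[of "T v" v])
  have uTv: "u \<bullet> T v = u \<bullet> u"
  proof -
    have "u \<bullet> u = u \<bullet> T v - \<mu> * (u \<bullet> v)"
      by (subst (2) u_def) (simp add: inner_diff_right)
    then show ?thesis by (simp add: uv)
  qed
  define c where "c = \<mu> * (u \<bullet> u) - u \<bullet> T u"
  have c0: "c \<ge> 0"
    using bound[OF uW] by (simp add: c_def)
  \<comment> \<open>\<open>bound\<close> at \<open>v + t *\<^sub>R u\<close>: a gain linear in
    \<open>t\<close> would have to be absorbed by a quadratic term for every
    \<open>t\<close>.\<close>
  have ineq: "2 * t * (u \<bullet> u) \<le> t\<^sup>2 * c" for t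
  proof -
    have "v + t *\<^sub>R u \<in> W"
      using v uW W(1) by (simp add: subspace_add subspace_scale)
    note bound[OF this]
    moreover have "v \<bullet> T u = u \<bullet> u"
      using sa[of v u] uTv by (simp add: inner_commute)
    then have "(v + t *\<^sub>R u) \<bullet> T (v + t *\<^sub>R u) = \<mu> + 2 * t * (u \<bullet> u) + t\<^sup>2 * (u \<bullet> T u)"
      by (simp add: linear_add[OF lin] linear_scale[OF lin] inner_add_left inner_add_right uTv
          \<mu>_def[symmetric] power2_eq_square distrib_left)
    moreover have "(v + t *\<^sub>R u) \<bullet> (v + t *\<^sub>R u) = 1 + t\<^sup>2 * (u \<bullet> u)"
      using uv vv by (simp add: inner_add_left inner_add_right inner_commute[of v u]
          power2_eq_square)
    ultimately have "\<mu> + 2 * t * (u \<bullet> u) + t\<^sup>2 * (u \<bullet> T u) \<le> \<mu> * (1 + t\<^sup>2 * (u \<bullet> u))"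
      by (simp only:)
    then show ?thesis
      by (simp add: c_def algebra_simps)
  qed
  have "u = 0"
  proof (rule ccontr)
    assume "u \<noteq> 0"
    then have n: "u \<bullet> u > 0" by simp
    \<comment> \<open>Small enough for the linear term to win; the \<open>+ 1\<close> keeps the
      denominator positive when \<open>c = 0\<close>.\<close>
    define t where "t = (u \<bullet> u) / (c + 1)"
    have t: "t > 0" using n c0 by (simp add: t_def)
    have "t * (2 * (u \<bullet> u)) \<le> t * (t * c)"
      using ineq[of t] by (simp add: power2_eq_square mult_ac)
    then have "2 * (u \<bullet> u) \<le> t * c"
      using t by (simp only: mult_le_cancel_left_pos)
    also have "\<dots> \<le> t * (c + 1)" using t by simp
    also have "\<dots> = u \<bullet> u" using c0 by (simp add: t_def)
    finally show False using n by simp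
  qed
  then show ?thesis
    using v by (auto simp: u_def intro!: exI[of _ v])
qed

section \<open>Hermitian inner product, rank-one matrices and functional calculus\<close>

definition cip :: "complex ^ 'n \<Rightarrow> complex ^ 'n::finite \<Rightarrow> complex" where
  "cip u v = (\<Sum>i\<in>UNIV. cnj (u $ i) * v $ i)"

definition outer :: "complex ^ 'n \<Rightarrow> 'n::finite cmat" where
  "outer v = (\<chi> i j. v $ i * cnj (v $ j))"

definition orthonormal :: "(complex ^ 'n::finite) set \<Rightarrow> bool" where
  "orthonormal S \<longleftrightarrow> (\<forall>s\<in>S. \<forall>t\<in>S. cip s t = (if s = t then 1 else 0))"

text \<open>For orthonormal \<open>S\<close>, the matrix with eigenvectors \<open>s\<close> and
  eigenvalues \<open>f s\<close>. With \<open>S\<close> fixed, functions of a Hermitian matrix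
  become functions of its eigenvalues.\<close>

definition spec :: "(complex ^ 'n) set \<Rightarrow> (complex ^ 'n \<Rightarrow> real) \<Rightarrow> 'n::finite cmat" where
  "spec S f = (\<Sum>s\<in>S. f s *\<^sub>R outer s)"

lemma Re_cip: "Re (cip u v) = u \<bullet> v"
  by (simp add: cip_def inner_vec_def inner_complex_def)

lemma linear_cip: "linear (cip u)"
  by (auto intro!: linearI simp: cip_def distrib_left sum.distrib scaleR_sum_right)

lemma cip_scale: "cip u (c *s v) = c * cip u v"
  by (simp add: cip_def sum_distrib_left mult_ac)

lemma cip_self: "cip v v = of_real (v \<bullet> v)"
  by (auto simp: complex_eq_iff Re_cip) (simp add: cip_def)

lemma outer_vector: "outer s *v x = cip s x *s s"
  by (simp add: outer_def cip_def matrix_vector_mult_def vec_eq_iff sum_distrib_left mult_ac)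

lemma outer_mult_outer: "outer s ** outer t = (\<chi> i j. cip s t * (s $ i * cnj (t $ j)))"
  by (simp add: outer_def cip_def matrix_matrix_mult_def vec_eq_iff sum_distrib_left mult_ac)

lemma matrix_mult_outer: "A ** outer s = (\<chi> i j. (A *v s) $ i * cnj (s $ j))"
  by (simp add: outer_def matrix_vector_mult_def matrix_matrix_mult_def vec_eq_iff
      sum_distrib_left mult_ac)

lemma dagger_outer: "dagger (outer s) = outer s"
  by (simp add: dagger_def outer_def vec_eq_iff)

lemma rtr_outer: "rtr (outer s) = s \<bullet> s"
  by (simp add: rtr_def trace_def outer_def inner_vec_def inner_complex_def)

lemma cip_dagger: "cip (dagger A *v x) y = cip x (A *v y)"
proof -
  have "cip (dagger A *v x) y = (\<Sum>i\<in>UNIV. \<Sum>j\<in>UNIV. A $ j $ i * cnj (x $ j) * y $ i)"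
    by (simp add: cip_def dagger_def matrix_vector_mult_def sum_distrib_right)
  also have "\<dots> = (\<Sum>j\<in>UNIV. \<Sum>i\<in>UNIV. A $ j $ i * cnj (x $ j) * y $ i)"
    by (rule sum.swap)
  finally show ?thesis
    by (simp add: cip_def matrix_vector_mult_def sum_distrib_left mult_ac)
qed

lemma orthonormal_independent: "orthonormal S \<Longrightarrow> independent S"
proof (rule pairwise_orthogonal_independent)
  assume S: "orthonormal S"
  show "pairwise orthogonal S"
    using S by (auto simp: pairwise_def orthogonal_def Re_cip[symmetric] orthonormal_def)
  show "0 \<notin> S"
  proof
    assume "0 \<in> S"
    then have "cip 0 (0 :: complex ^ 'a) = 1" using S by (simp add: orthonormal_def)
    then show False by (simp add: cip_def)
  qed
qed

lemma outer_orthonormal: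
  "orthonormal S \<Longrightarrow> s \<in> S \<Longrightarrow> t \<in> S \<Longrightarrow> outer s ** outer t = (if s = t then outer s else 0)"
  unfolding outer_mult_outer by (auto simp: orthonormal_def outer_def vec_eq_iff)

lemma scaleR_matrix_vector: "(c *\<^sub>R A) *v x = c *\<^sub>R (A *v (x :: complex ^ 'n::finite))"
  by (simp add: matrix_vector_mult_def vec_eq_iff scaleR_sum_right)

text \<open>An orthonormal set of eigenvectors of maximal cardinality must be complete: its complex
  orthogonal complement is invariant under \<open>A\<close>, so a nonzero complement would contain
  one more eigenvector.\<close>

theorem hermitian_spectral:
  assumes A: "hermitian A"
  obtains S \<mu> where "finite S" "orthonormal S" "spec S (\<lambda>_. 1) = mat 1" "A = spec S \<mu>"
proof -
  have dA: "dagger A = A"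
    using A by (simp add: hermitian_iff_dagger)
  define Q where "Q S \<longleftrightarrow> orthonormal S \<and> (\<forall>s\<in>S. \<exists>m::real. A *v s = m *\<^sub>R s)" for S
  have "Q {}" by (simp add: Q_def orthonormal_def)
  \<comment> \<open>Orthonormal sets are independent over the reals, so the real dimension bounds
    their size; any bound suffices for a maximum to exist.\<close>
  moreover have "Q S \<Longrightarrow> card S < Suc (DIM(complex ^ 'a))" for S
    unfolding less_Suc_eq_le by (metis Q_def orthonormal_independent independent_bound)
  ultimately have "\<exists>S. Q S \<and> (\<forall>T. Q T \<longrightarrow> card T \<le> card S)"
    using ex_has_greatest_nat[of Q "{}" card] by blast
  then obtain S where S: "Q S" and max: "\<And>T. Q T \<Longrightarrow> card T \<le> card S"
    by blast
  have on: "orthonormal S" and fin: "finite S"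
    using S by (auto simp: Q_def orthonormal_independent independent_imp_finite)
  obtain \<mu> where mu: "\<And>s. s \<in> S \<Longrightarrow> A *v s = \<mu> s *\<^sub>R s"
    using S unfolding Q_def by metis
  define W where "W = {v. \<forall>s\<in>S. cip s v = 0}"
  have W0: "W = {0}"
  proof (rule ccontr)
    assume "W \<noteq> {0}"
    moreover have "subspace W"
      by (auto simp: W_def subspace_def linear_0[OF linear_cip] linear_add[OF linear_cip]
          linear_scale[OF linear_cip])
    moreover have "A *v x \<in> W" if "x \<in> W" for x
    proof -
      have "cip s (A *v x) = 0" if "s \<in> S" for s
      proof -
        have "cip s (A *v x) = cip (\<mu> s *\<^sub>R s) x"
          by (metis cip_dagger dA mu that)
        also have "\<dots> = of_real (\<mu> s) * cip s x"
          by (simp add: cip_def sum_distrib_left mult_ac scaleR_conv_of_real[of _ "_ :: complex"])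
        finally show ?thesis
          using \<open>x \<in> W\<close> that by (simp add: W_def)
      qed
      then show ?thesis by (simp add: W_def)
    qed
    moreover have "(A *v x) \<bullet> y = x \<bullet> (A *v y)" for x y
      by (metis Re_cip cip_dagger dA)
    ultimately obtain v m where v: "v \<in> W" "norm v = 1" "A *v v = m *\<^sub>R v"
      using selfadjoint_eigenvector_exists[of "(*v) A" W] by auto
    have vS: "cip s v = 0" "cip v s = 0" if "s \<in> S" for s
    proof -
      show "cip s v = 0" using v that by (simp add: W_def)
      have "cip v s = cnj (cip s v)" by (simp add: cip_def mult.commute)
      then show "cip v s = 0" using \<open>cip s v = 0\<close> by simp
    qed
    have vv: "cip v v = 1"
      using v(2) by (simp add: cip_self norm_eq_1)
    then have "v \<notin> S" using vS by force
    moreover have "Q (insert v S)"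
      using S vS vv v(3) by (auto simp: Q_def orthonormal_def)
    ultimately show False
      using max[of "insert v S"] fin by simp
  qed
  have one: "spec S (\<lambda>_. 1) = mat 1"
  proof -
    have "spec S (\<lambda>_. 1) *v x = x" for x
    proof -
      have ex: "spec S (\<lambda>_. 1) *v x = (\<Sum>s\<in>S. cip s x *s s)"
        unfolding spec_def outer_vector[symmetric]
        using fin by (induction S rule: finite_induct)
          (auto simp: matrix_vector_mult_add_rdistrib)
      have "cip t (\<Sum>s\<in>S. cip s x *s s) = cip t x" if "t \<in> S" for t
      proof -
        have "cip t (\<Sum>s\<in>S. cip s x *s s) = (\<Sum>s\<in>S. cip s x * cip t s)"
          by (simp add: linear_sum[OF linear_cip] cip_scale)
        also have "\<dots> = (\<Sum>s\<in>S. if s = t then cip s x else 0)"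
          using on that by (intro sum.cong) (auto simp: orthonormal_def)
        finally show ?thesis using fin that by simp
      qed
      \<comment> \<open>The error of the expansion of \<open>x\<close> in \<open>S\<close> is
        orthogonal to \<open>S\<close>, hence zero.\<close>
      then have "x - (\<Sum>s\<in>S. cip s x *s s) \<in> W"
        by (simp add: W_def linear_diff[OF linear_cip])
      then show ?thesis using W0 ex by simp
    qed
    then show ?thesis by (simp add: matrix_eq)
  qed
  have "A = A ** spec S (\<lambda>_. 1)" by (simp add: one)
  also have "\<dots> = (\<Sum>s\<in>S. A ** outer s)"
    by (simp add: spec_def bounded_bilinear.sum_right[OF bounded_bilinear_matrix_mult])
  also have "\<dots> = spec S \<mu>"
    unfolding spec_def matrix_mult_outer
    by (rule sum.cong) (auto simp: mu outer_def vec_eq_iff)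
  finally show ?thesis by (rule that[OF fin on one])
qed

lemma spec_cong: "(\<And>s. s \<in> S \<Longrightarrow> f s = g s) \<Longrightarrow> spec S f = spec S g"
  by (simp add: spec_def)

lemma spec_mult:
  assumes "finite S" "orthonormal S"
  shows "spec S f ** spec S g = spec S (\<lambda>s. f s * g s)"
proof -
  have "spec S f ** spec S g = (\<Sum>s\<in>S. \<Sum>t\<in>S. (f s * g t) *\<^sub>R (outer s ** outer t))"
    unfolding spec_def bounded_bilinear.sum_left[OF bounded_bilinear_matrix_mult]
    by (simp add: bounded_bilinear.sum_right[OF bounded_bilinear_matrix_mult] mm_distribs
        mult.commute)
  also have "\<dots> = (\<Sum>s\<in>S. \<Sum>t\<in>S. if t = s then (f s * g s) *\<^sub>R outer s else 0)"
    using assms by (intro sum.cong refl) (auto simp: outer_orthonormal)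
  also have "\<dots> = spec S (\<lambda>s. f s * g s)"
    using assms by (simp add: spec_def)
  finally show ?thesis .
qed

lemma dagger_spec: "dagger (spec S f) = spec S f"
  by (simp add: spec_def linear_sum[OF linear_dagger] dagger_distribs dagger_outer)

lemma hermitian_spec: "hermitian (spec S f)"
  by (simp add: hermitian_iff_dagger dagger_spec)

lemma rtr_spec: "orthonormal S \<Longrightarrow> rtr (spec S f) = sum f S"
  unfolding spec_def by (simp add: linear_sum[OF linear_rtr] rtr_distribs rtr_outer
      Re_cip[symmetric] orthonormal_def)

lemma scaleR_spec: "c *\<^sub>R spec S f = spec S (\<lambda>s. c * f s)"
  by (simp add: spec_def scaleR_sum_right)

section \<open>Square roots of positive semidefinite matrices\<close>

lemma psd_iff_inner: "psd A \<longleftrightarrow> hermitian A \<and> (\<forall>v. 0 \<le> v \<bullet> (A *v v))"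
  by (simp add: psd_def Re_cip[symmetric] cip_def)

lemma psd_gram: "psd (dagger B ** B)"
  unfolding psd_iff_inner
proof (intro conjI allI)
  show "hermitian (dagger B ** B)"
    by (simp add: hermitian_iff_dagger dagger_mult)
  fix v
  have "v \<bullet> ((dagger B ** B) *v v) = (B *v v) \<bullet> (B *v v)"
    by (metis Re_cip cip_dagger dagger_dagger matrix_vector_mul_assoc)
  then show "0 \<le> v \<bullet> ((dagger B ** B) *v v)" by simp
qed

lemma psd_sqrt_exists:
  assumes "psd A"
  shows "\<exists>B. psd B \<and> B ** B = A"
proof -
  obtain S \<mu> where S: "finite S" "orthonormal S" "A = spec S \<mu>"
    using hermitian_spectral assms psd_def by metis
  have mu: "\<mu> s \<ge> 0" if s: "s \<in> S" for s
  proof -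
    have "A ** outer s = \<mu> s *\<^sub>R outer s"
    proof -
      have "A ** outer s = (\<Sum>t\<in>S. if t = s then \<mu> s *\<^sub>R outer s else 0)"
        unfolding S(3) spec_def
        by (subst bounded_bilinear.sum_left[OF bounded_bilinear_matrix_mult], rule sum.cong)
          (auto simp: mm_distribs outer_orthonormal[OF S(2)] s)
      then show ?thesis using S s by simp
    qed
    then have "(A ** outer s) *v s = (\<mu> s *\<^sub>R outer s) *v s" by simp
    moreover have "outer s *v s = s"
      using S(2) s by (simp add: outer_vector orthonormal_def)
    ultimately have "A *v s = \<mu> s *\<^sub>R s"
      by (simp add: matrix_vector_mul_assoc[symmetric] scaleR_matrix_vector)
    then have "0 \<le> \<mu> s * (s \<bullet> s)"
      using assms by (metis inner_scaleR_right psd_iff_inner)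
    moreover have "s \<bullet> s = 1"
      using S(2) s by (simp add: Re_cip[symmetric] orthonormal_def)
    ultimately show ?thesis by simp
  qed
  \<comment> \<open>The fourth root \<open>?C\<close> is there to exhibit \<open>?B\<close> as a
    Gram matrix, hence as positive semidefinite.\<close>
  let ?B = "spec S (\<lambda>s. sqrt (\<mu> s))" and ?C = "spec S (\<lambda>s. sqrt (sqrt (\<mu> s)))"
  have "?C ** ?C = ?B" and "?B ** ?B = A"
    using mu S by (simp_all add: spec_mult cong: spec_cong)
  moreover from this have "psd ?B"
    using psd_gram[of ?C] by (simp add: dagger_spec)
  ultimately show ?thesis by blast
qed

lemma psd_sqrt:
  assumes "psd A"
  shows "psd (psd_sqrt A)" "psd_sqrt A ** psd_sqrt A = A"
  using someI_ex[OF psd_sqrt_exists[OF assms]] by (auto simp: psd_sqrt_def)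

section \<open>Positive semidefinite matrices and the anticommutator equation\<close>

lemma psd_dagger: "psd A \<Longrightarrow> dagger A = A"
  by (simp add: psd_def hermitian_iff_dagger)

text \<open>With a Hermitian root \<open>B\<close> of \<open>A\<close>, the sandwich is the Gram
  matrix of \<open>dagger (Y ** B)\<close>.\<close>

lemma psd_sandwich:
  assumes "psd A"
  shows "0 \<le> rtr (Y ** A ** dagger Y)" and "rtr (Y ** A ** dagger Y) = 0 \<Longrightarrow> Y ** A = 0"
proof -
  obtain B where B: "dagger B = B" "B ** B = A"
    using psd_sqrt_exists[OF assms] psd_dagger by blast
  have eq: "Y ** A ** dagger Y = dagger (dagger (Y ** B)) ** dagger (Y ** B)"
    by (simp add: dagger_mult B(1) matrix_mul_assoc flip: B(2))
  show "0 \<le> rtr (Y ** A ** dagger Y)"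
    unfolding eq by (rule rtr_gram_nonneg)
  assume "rtr (Y ** A ** dagger Y) = 0"
  then have "dagger (Y ** B) = 0"
    unfolding eq by (simp only: rtr_gram_eq_0_iff)
  then have "Y ** B = 0"
    by (metis dagger_dagger linear_0[OF linear_dagger])
  then show "Y ** A = 0"
    by (simp add: B(2)[symmetric] matrix_mul_assoc mm_zero)
qed

text \<open>Multiplying the equation by \<open>dagger C\<close> and taking the trace gives two
  nonnegative terms with sum zero.\<close>

lemma psd_anticommute_0:
  assumes K: "psd K" and KC: "K ** C + C ** K = 0"
  shows "K ** C = 0" "C ** K = 0"
proof -
  have "rtr (dagger C ** K ** C) + rtr (C ** K ** dagger C) = rtr (dagger C ** (K ** C + C ** K))"
    by (simp add: mm_distribs rtr_distribs matrix_mul_assoc)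
      (metis rtr_commute matrix_mul_assoc)
  also have "\<dots> = 0"
    by (simp add: KC mm_zero rtr_distribs)
  finally have *: "rtr (dagger C ** K ** C) + rtr (C ** K ** dagger C) = 0" .
  moreover have "0 \<le> rtr (dagger C ** K ** C)" "0 \<le> rtr (C ** K ** dagger C)"
    using psd_sandwich(1)[OF K, of "dagger C"] psd_sandwich(1)[OF K, of C] by simp_all
  ultimately have "rtr (C ** K ** dagger C) = 0" by linarith
  then show "C ** K = 0" by (rule psd_sandwich(2)[OF K])
  then show "K ** C = 0" using KC by simp
qed

text \<open>The commutator \<open>C\<close> of \<open>A\<close> and \<open>K\<close> anticommutes
  with \<open>K\<close>, so its products with \<open>K\<close> vanish, and with them the Gram trace
  of \<open>dagger C\<close>. This carries commutation with a POVM element over to its root.\<close>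

lemma commute_psd_root:
  assumes A: "hermitian A" and K: "psd K" and AK: "A ** (K ** K) = (K ** K) ** A"
  shows "A ** K = K ** A"
proof -
  define C where "C = A ** K - K ** A"
  have "K ** C + C ** K = 0"
    using AK by (simp add: C_def mm_distribs matrix_mul_assoc)
  note C0 = psd_anticommute_0[OF K this]
  have dC: "dagger C = K ** A - A ** K"
    using A psd_dagger[OF K] by (simp add: C_def dagger_distribs dagger_mult hermitian_iff_dagger)
  have "rtr (dagger (dagger C) ** dagger C) = rtr (C ** K ** A) - rtr ((C ** A) ** K)"
    by (simp add: dC[symmetric]) (simp add: dC mm_distribs rtr_distribs matrix_mul_assoc)
  also have "\<dots> = rtr (C ** K ** A) - rtr (K ** C ** A)"
    by (simp add: rtr_commute[of "C ** A" K] matrix_mul_assoc)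
  also have "\<dots> = 0"
    by (simp add: C0 mm_zero rtr_distribs)
  finally have "dagger C = 0" by (simp only: rtr_gram_eq_0_iff)
  then show ?thesis by (simp add: dC)
qed

text \<open>The anticommutator with \<open>\<sigma>\<close> is self-adjoint for the real inner product of matrices, so its
  range is the orthogonal complement of its kernel.\<close>

lemma anticommutator_equation:
  fixes \<sigma> :: "'n::finite cmat"
  assumes psd: "psd \<sigma>" and D: "hermitian D" and ker: "\<And>N :: 'n cmat. \<sigma> ** N = 0 \<Longrightarrow> D ** N = 0"
  shows "\<exists>L. hermitian L \<and> D = (1/2) *\<^sub>R (\<sigma> ** L + L ** \<sigma>)"
proof -
  define T where "T L = \<sigma> ** L + L ** \<sigma>" for L
  have lin: "linear T"
    by (rule linearI) (simp_all add: T_def mm_distribs scaleR_add_right)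
  have ds: "dagger \<sigma> = \<sigma>" using psd by (rule psd_dagger)
  have dD: "dagger D = D" using D by (simp add: hermitian_iff_dagger)
  have sa: "A \<bullet> T B = T A \<bullet> B" for A B
  proof -
    have "rtr (dagger A ** B ** \<sigma>) = rtr (\<sigma> ** dagger A ** B)"
      by (metis rtr_commute matrix_mul_assoc)
    then show ?thesis
      by (simp add: inner_eq_rtr T_def dagger_distribs dagger_mult ds mm_distribs rtr_distribs
          matrix_mul_assoc)
  qed
  \<comment> \<open>It remains to see that the component \<open>z\<close> orthogonal to the range of
    \<open>T\<close> is zero: self-adjointness puts it in the kernel of \<open>T\<close>, and
    \<open>ker\<close> then makes \<open>D\<close> orthogonal to it.\<close>
  obtain y z where y: "y \<in> span (range T)" and z: "\<And>w. w \<in> span (range T) \<Longrightarrow> orthogonal z w"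
    and Dyz: "D = y + z"
    using orthogonal_subspace_decomp_exists by blast
  have span: "span (range T) = range T"
    using lin by (simp add: linear_subspace_image span_eq_iff)
  have "T z \<bullet> T z = 0"
    using z[of "T (T z)"] by (simp add: span orthogonal_def sa)
  then have "\<sigma> ** z + z ** \<sigma> = 0" by (simp add: T_def)
  then have "D ** z = 0"
    by (rule ker[OF psd_anticommute_0(1)[OF psd]])
  then have "D \<bullet> z = 0"
    by (simp add: inner_eq_rtr dD rtr_distribs)
  moreover have "y \<bullet> z = 0"
    using z[OF y] by (simp add: orthogonal_def inner_commute)
  ultimately have "z = 0" by (simp add: Dyz inner_add_left)
  moreover have "y \<in> range T" using y by (simp only: span)
  ultimately obtain M where M: "D = \<sigma> ** M + M ** \<sigma>"
    using Dyz by (auto simp: T_def)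
  then have M': "D = \<sigma> ** dagger M + dagger M ** \<sigma>"
    using dD by (metis add.commute dagger_distribs(1) dagger_mult ds)
  \<comment> \<open>\<open>M\<close> need not be Hermitian, but \<open>dagger M\<close> is a
    solution too. Their average is Hermitian; the factor \<open>1/2\<close> of the equation turns it
    into the sum.\<close>
  have "D = (1/2) *\<^sub>R (D + D)"
    by (simp add: scaleR_2[symmetric])
  also have "\<dots> = (1/2) *\<^sub>R (\<sigma> ** (M + dagger M) + (M + dagger M) ** \<sigma>)"
    by (subst (1) M, subst M') (simp add: mm_distribs algebra_simps)
  finally have "D = (1/2) *\<^sub>R (\<sigma> ** (M + dagger M) + (M + dagger M) ** \<sigma>)" .
  moreover have "hermitian (M + dagger M)"
    by (simp add: hermitian_iff_dagger dagger_distribs add.commute)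
  ultimately show ?thesis by blast
qed

text \<open>With \<open>M = L\<close> the information is the trace of derivative times
  \<open>L\<close>; with \<open>M = mat 1\<close> the mean of \<open>L\<close> is the trace of the
  derivative.\<close>

lemma rtr_anticommutator:
  "rtr ((1/2) *\<^sub>R (\<sigma> ** L + L ** \<sigma>) ** M) = (rtr (\<sigma> ** (L ** M)) + rtr (\<sigma> ** (M ** L))) / 2"
proof -
  have "rtr (L ** \<sigma> ** M) = rtr (\<sigma> ** M ** L)"
    by (metis rtr_commute matrix_mul_assoc)
  then show ?thesis
    by (simp add: mm_distribs rtr_distribs matrix_mul_assoc)
qed

text \<open>Both sides equal the symmetrized trace of \<open>\<sigma>\<close> with \<open>L\<close>
  and \<open>M\<close>. This makes the quantum Fisher information independent of the choice made by
  \<open>SOME\<close>.\<close>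

lemma anticommutator_solution_unique_square:
  assumes "(1/2) *\<^sub>R (\<sigma> ** L + L ** \<sigma>) = (1/2) *\<^sub>R (\<sigma> ** M + M ** \<sigma>)"
  shows "rtr (\<sigma> ** (L ** L)) = rtr (\<sigma> ** (M ** M))"
  using rtr_anticommutator[of \<sigma> L L] rtr_anticommutator[of \<sigma> M L]
    rtr_anticommutator[of \<sigma> L M] rtr_anticommutator[of \<sigma> M M] assms by simp

text \<open>The difference of the two sides is \<open>rtr (Y ** \<rho> ** dagger Y)\<close> for \<open>Y = M ** K - K ** L\<close>.\<close>

lemma compressed_information_le:
  assumes rho: "psd \<rho>" and K: "hermitian K" and L: "hermitian L" and M: "hermitian M"
    and eq: "(1/2) *\<^sub>R ((K ** \<rho> ** K) ** M + M ** (K ** \<rho> ** K)) =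
      K ** ((1/2) *\<^sub>R (\<rho> ** L + L ** \<rho>)) ** K"
  shows "rtr ((K ** \<rho> ** K) ** (M ** M)) \<le> rtr (L ** \<rho> ** L ** (K ** K))"
proof -
  define Y where "Y = M ** K - K ** L"
  define \<sigma> where "\<sigma> = K ** \<rho> ** K"
  have dY: "dagger Y = K ** M - L ** K"
    using K L M by (simp add: Y_def dagger_distribs dagger_mult hermitian_iff_dagger)
  have "rtr (\<sigma> ** (M ** M)) = rtr ((1/2) *\<^sub>R (\<sigma> ** M + M ** \<sigma>) ** M)"
    by (simp add: rtr_anticommutator)
  also have "\<dots> = rtr (K ** ((1/2) *\<^sub>R (\<rho> ** L + L ** \<rho>)) ** K ** M)"
    using eq by (simp add: \<sigma>_def)
  also have "\<dots> = (rtr (K ** \<rho> ** L ** K ** M) + rtr (K ** L ** \<rho> ** K ** M)) / 2"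
    by (simp add: mm_distribs rtr_distribs matrix_mul_assoc)
  \<comment> \<open>The two cross terms of \<open>Y ** \<rho> ** dagger Y\<close>: they enter
    negatively and add up to twice the left-hand side of the claim, while the square of
    \<open>M\<close> contributes it once.\<close>
  finally have two: "2 * rtr (\<sigma> ** (M ** M)) =
    rtr (K ** \<rho> ** L ** K ** M) + rtr (K ** L ** \<rho> ** K ** M)" by simp
  have 1: "rtr (M ** K ** \<rho> ** K ** M) = rtr (\<sigma> ** (M ** M))"
    unfolding \<sigma>_def by (metis rtr_commute matrix_mul_assoc)
  have 2: "rtr (M ** K ** \<rho> ** L ** K) = rtr (K ** \<rho> ** L ** K ** M)"
    by (metis rtr_commute matrix_mul_assoc)
  have 3: "rtr (K ** L ** \<rho> ** L ** K) = rtr (L ** \<rho> ** L ** (K ** K))"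
    by (metis rtr_commute matrix_mul_assoc)
  have "0 \<le> rtr (Y ** \<rho> ** dagger Y)" by (rule psd_sandwich(1)[OF rho])
  also have "\<dots> = rtr (M ** K ** \<rho> ** K ** M) - rtr (M ** K ** \<rho> ** L ** K)
      - (rtr (K ** L ** \<rho> ** K ** M) - rtr (K ** L ** \<rho> ** L ** K))"
    unfolding dY by (simp add: Y_def mm_distribs rtr_distribs matrix_mul_assoc)
  finally show ?thesis using two 1 2 3 by (simp add: \<sigma>_def)
qed

text \<open>If \<open>K\<close> commutes with \<open>L\<close>, then \<open>L\<close> itself solves
  the equation for \<open>M\<close>, and the trace does not depend on the solution.\<close>

lemma compressed_information_eq:
  assumes KL: "K ** L = L ** K"
    and eq: "(1/2) *\<^sub>R ((K ** \<rho> ** K) ** M + M ** (K ** \<rho> ** K)) =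
      K ** ((1/2) *\<^sub>R (\<rho> ** L + L ** \<rho>)) ** K"
  shows "rtr ((K ** \<rho> ** K) ** (M ** M)) = rtr (L ** \<rho> ** L ** (K ** K))"
proof -
  have "K ** ((1/2) *\<^sub>R (\<rho> ** L + L ** \<rho>)) ** K =
      (1/2) *\<^sub>R ((K ** \<rho> ** K) ** L + L ** (K ** \<rho> ** K))"
  proof -
    have "K ** \<rho> ** (L ** K) = K ** \<rho> ** (K ** L)" "(K ** L) ** \<rho> ** K = (L ** K) ** \<rho> ** K"
      using KL by simp_all
    then show ?thesis by (simp add: mm_distribs matrix_mul_assoc)
  qed
  then have "rtr ((K ** \<rho> ** K) ** (M ** M)) = rtr ((K ** \<rho> ** K) ** (L ** L))"
    using anticommutator_solution_unique_square eq by metis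
  also have "\<dots> = rtr (\<rho> ** ((K ** L) ** (L ** K)))"
    by (metis rtr_commute matrix_mul_assoc)
  also have "\<dots> = rtr (\<rho> ** ((L ** K) ** (K ** L)))"
    by (simp only: KL)
  also have "\<dots> = rtr (L ** \<rho> ** L ** (K ** K))"
    by (metis rtr_commute matrix_mul_assoc)
  finally show ?thesis .
qed

section \<open>Thermal states\<close>

lemma matrix_power_spec:
  assumes "finite S" "orthonormal S" "spec S (\<lambda>_. 1) = mat 1"
  shows "matrix_power (spec S f) k = spec S (\<lambda>s. f s ^ k)"
  using assms by (induction k) (simp_all add: matrix_power_def spec_mult)

lemma matrix_exp_spec:
  assumes "finite S" "orthonormal S" "spec S (\<lambda>_. 1) = mat 1"
  shows "matrix_exp (spec S f) = spec S (\<lambda>s. exp (f s))"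
proof -
  have "(\<lambda>k. spec S (\<lambda>s. f s ^ k /\<^sub>R fact k)) sums spec S (\<lambda>s. exp (f s))"
    unfolding spec_def by (intro sums_sum sums_scaleR_left exp_converges)
  then show ?thesis
    unfolding matrix_exp_def matrix_power_spec[OF assms] scaleR_spec
    by (simp add: sums_unique[symmetric])
qed

lemma spec_has_vector_derivative:
  assumes "\<And>s. s \<in> S \<Longrightarrow> ((\<lambda>b. w b s) has_real_derivative w' s) (at \<beta>)"
  shows "((\<lambda>b. spec S (w b)) has_vector_derivative spec S w') (at \<beta>)"
  unfolding spec_def
  using assms by (auto intro!: derivative_eq_intros simp: has_real_derivative_iff_has_vector_derivative)

text \<open>Everything is diagonal in an eigenbasis of \<open>H\<close>. The matrix
  \<open>R\<close>, a root of the state that can be cancelled on the left, records that the state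
  has full rank.\<close>

lemma thermal_state_sld:
  fixes H :: "'n::finite cmat"
  assumes "hermitian H"
  obtains L R where "is_sld (thermal_state H) \<beta> L"
    and "L ** thermal_state H \<beta> = thermal_state H \<beta> ** L"
    and "hermitian R" "R ** R = thermal_state H \<beta>" "\<And>N :: 'n cmat. R ** N = 0 \<Longrightarrow> N = 0"
proof -
  obtain S \<mu> where S: "finite S" "orthonormal S" "spec S (\<lambda>_. 1) = mat 1" and H: "H = spec S \<mu>"
    using hermitian_spectral[OF assms] by metis
  define Z where "Z b = (\<Sum>s\<in>S. exp (- b * \<mu> s))" for b
  define w where "w b s = exp (- b * \<mu> s) / Z b" for b s
  define Z' where "Z' = (\<Sum>s\<in>S. - \<mu> s * exp (- \<beta> * \<mu> s))"
  \<comment> \<open>The logarithmic derivative of the Gibbs weight \<open>w b s\<close> at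
    \<open>b = \<beta>\<close>. As \<open>- Z' / Z \<beta>\<close> is the mean energy,
    \<open>spec S l\<close> is the mean energy minus \<open>H\<close>.\<close>
  define l where "l s = - \<mu> s - Z' / Z \<beta>" for s
  have state: "thermal_state H b = spec S (w b)" for b
    unfolding thermal_state_def H w_def Z_def scaleR_spec matrix_exp_spec[OF S]
      rtr_def[symmetric] rtr_spec[OF S(2)]
    by (simp add: divide_inverse mult.commute)
  have "S \<noteq> {}"
  proof
    assume "S = {}"
    then have "rtr (mat 1 :: 'n cmat) = 0"
      using S(3) by (simp add: spec_def rtr_distribs flip: S(3))
    then show False by (simp add: rtr_def trace_I)
  qed
  then have Zpos: "Z b > 0" for b
    unfolding Z_def using S(1) by (intro sum_pos) auto
  then have wpos: "w b s > 0" for b s by (simp add: w_def)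
  have "(Z has_real_derivative Z') (at \<beta>)"
    unfolding Z_def[abs_def] Z'_def by (auto intro!: derivative_eq_intros simp: mult.commute)
  then have "((\<lambda>b. w b s) has_real_derivative w \<beta> s * l s) (at \<beta>)" for s
    unfolding w_def l_def using Zpos[of \<beta>]
    by (auto intro!: derivative_eq_intros simp: field_simps power2_eq_square)
  then have der: "(thermal_state H has_vector_derivative spec S (\<lambda>s. w \<beta> s * l s)) (at \<beta>)"
    unfolding state[abs_def] by (rule spec_has_vector_derivative)
  have comm: "thermal_state H \<beta> ** spec S l = spec S (\<lambda>s. w \<beta> s * l s)"
    "spec S l ** thermal_state H \<beta> = spec S (\<lambda>s. w \<beta> s * l s)"
    using S by (simp_all add: state spec_mult mult.commute)
  have "is_sld (thermal_state H) \<beta> (spec S l)"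
    unfolding is_sld_def comm using der by (simp add: hermitian_spec flip: scaleR_2)
  moreover have "spec S l ** thermal_state H \<beta> = thermal_state H \<beta> ** spec S l"
    by (simp add: comm)
  moreover have "spec S (\<lambda>s. sqrt (w \<beta> s)) ** spec S (\<lambda>s. sqrt (w \<beta> s)) = thermal_state H \<beta>"
    using S wpos by (simp add: spec_mult state less_imp_le)
  moreover have "N = 0" if "spec S (\<lambda>s. sqrt (w \<beta> s)) ** N = 0" for N :: "'n cmat"
  proof -
    have "spec S (\<lambda>s. inverse (sqrt (w \<beta> s))) ** spec S (\<lambda>s. sqrt (w \<beta> s)) = mat 1"
      using S wpos[of \<beta>] by (simp add: spec_mult less_imp_neq[symmetric])
    then have "N = spec S (\<lambda>s. inverse (sqrt (w \<beta> s))) ** (spec S (\<lambda>s. sqrt (w \<beta> s)) ** N)"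
      by (simp add: matrix_mul_assoc)
    then show ?thesis by (simp add: that mm_zero)
  qed
  ultimately show ?thesis
    using that hermitian_spec by blast
qed

section \<open>Information carried by a single outcome\<close>

lemma outcome_prob_has_derivative:
  assumes "(\<rho> has_vector_derivative D) (at \<beta>)"
  shows "(outcome_prob \<rho> P has_real_derivative rtr (D ** P)) (at \<beta>)"
proof -
  have "linear (\<lambda>A. rtr (A ** P))"
    by (rule linearI) (simp_all add: mm_distribs rtr_distribs)
  then have "bounded_linear (\<lambda>A. rtr (A ** P))" by (simp add: linear_conv_bounded_linear)
  from bounded_linear.has_vector_derivative[OF this assms] show ?thesis
    by (simp add: has_real_derivative_iff_has_vector_derivative outcome_prob_def[abs_def]
        rtr_def)
qed

lemma conditional_state_has_derivative:
  assumes "(\<rho> has_vector_derivative D) (at \<beta>)" and "outcome_prob \<rho> P \<beta> \<noteq> 0"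
  defines "K \<equiv> psd_sqrt P" and "p \<equiv> outcome_prob \<rho> P \<beta>"
  shows "(conditional_state \<rho> P has_vector_derivative
    (K ** D ** K) /\<^sub>R p - (rtr (D ** P) / p) *\<^sub>R conditional_state \<rho> P \<beta>) (at \<beta>)"
proof -
  have "linear (\<lambda>A. K ** A ** K)"
    by (rule linearI) (simp_all add: mm_distribs)
  then have "bounded_linear (\<lambda>A. K ** A ** K)" by (simp add: linear_conv_bounded_linear)
  from bounded_linear.has_vector_derivative[OF this assms(1)]
  have num: "((\<lambda>b. K ** \<rho> b ** K) has_vector_derivative K ** D ** K) (at \<beta>)" .
  have "((\<lambda>b. inverse (outcome_prob \<rho> P b)) has_real_derivative - (rtr (D ** P) / p\<^sup>2)) (at \<beta>)"
    using DERIV_inverse_fun[OF outcome_prob_has_derivative[OF assms(1)] assms(2)]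
    by (simp add: p_def power2_eq_square divide_inverse mult_ac)
  from has_vector_derivative_scaleR[OF this num] show ?thesis
    unfolding conditional_state_def[abs_def] K_def[symmetric]
    by (simp add: p_def[symmetric] power2_eq_square divide_inverse mult_ac)
qed

lemma rtr_conditional_state:
  assumes "psd P" "outcome_prob \<rho> P \<beta> \<noteq> 0"
  shows "rtr (conditional_state \<rho> P \<beta>) = 1"
proof -
  let ?K = "psd_sqrt P"
  have "rtr (?K ** \<rho> \<beta> ** ?K) = rtr (\<rho> \<beta> ** (?K ** ?K))"
    by (metis rtr_commute matrix_mul_assoc)
  then show ?thesis
    using assms psd_sqrt(2)[OF assms(1)]
    by (simp add: conditional_state_def rtr_distribs outcome_prob_def flip: rtr_def)
qed

text \<open>Normalization shifts the symmetric logarithmic derivative \<open>N\<close> of the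
  conditional state by the score \<open>c\<close> of the outcome. Since \<open>N\<close> has mean
  zero, the square of \<open>N + c *\<^sub>R mat 1\<close> has no cross term in the mean and splits
  into the two informations.\<close>

lemma outcome_information:
  fixes \<rho> :: "real \<Rightarrow> 'n::finite cmat"
  assumes P: "psd P" "P \<noteq> 0" and sld: "is_sld \<rho> \<beta> L"
    and R: "hermitian R" "R ** R = \<rho> \<beta>" "\<And>N :: 'n cmat. R ** N = 0 \<Longrightarrow> N = 0"
  defines "K \<equiv> psd_sqrt P" and "p \<equiv> outcome_prob \<rho> P \<beta>"
  obtains M where "hermitian M"
    and "(1/2) *\<^sub>R ((K ** \<rho> \<beta> ** K) ** M + M ** (K ** \<rho> \<beta> ** K)) =
      K ** ((1/2) *\<^sub>R (\<rho> \<beta> ** L + L ** \<rho> \<beta>)) ** K"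
    and "p * (deriv (\<lambda>b. ln (outcome_prob \<rho> P b)) \<beta>)\<^sup>2 +
      p * quantum_fisher_information (conditional_state \<rho> P) \<beta> = rtr ((K ** \<rho> \<beta> ** K) ** (M ** M))"
    and "p > 0" "quantum_fisher_information (conditional_state \<rho> P) \<beta> \<ge> 0"
proof -
  define D where "D = (1/2) *\<^sub>R (\<rho> \<beta> ** L + L ** \<rho> \<beta>)"
  define \<sigma> where "\<sigma> = conditional_state \<rho> P \<beta>"
  define q where "q = rtr (D ** P)"
  have dR: "dagger R = R" using R(1) by (simp add: hermitian_iff_dagger)
  have K: "psd K" "dagger K = K" "K ** K = P"
    using psd_sqrt[OF P(1)] psd_dagger by (auto simp: K_def)
  have gram: "K ** \<rho> \<beta> ** K = dagger (R ** K) ** (R ** K)"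
    by (simp add: dagger_mult dR K(2) matrix_mul_assoc flip: R(2))
  have dL: "dagger L = L" and der: "(\<rho> has_vector_derivative D) (at \<beta>)"
    using sld by (auto simp: is_sld_def D_def hermitian_iff_dagger)
  have drho: "dagger (\<rho> \<beta>) = \<rho> \<beta>"
    by (simp add: dagger_mult dR flip: R(2))
  have dD: "dagger D = D"
    by (simp add: D_def dagger_distribs dagger_mult dL drho add.commute)
  have "p = rtr (K ** \<rho> \<beta> ** K)"
    unfolding p_def outcome_prob_def rtr_def[symmetric] K(3)[symmetric]
    by (metis rtr_commute matrix_mul_assoc)
  \<comment> \<open>Full rank of the model: the probability is the squared norm of
    \<open>R ** K\<close>, which vanishes only for \<open>P = 0\<close>.\<close>
  moreover have "R ** K \<noteq> 0"
    using R(3)[of K] P(2) K(3) by (auto simp: mm_zero)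
  ultimately have p: "p > 0"
    using rtr_gram_nonneg[of "R ** K"] rtr_gram_eq_0_iff[of "R ** K"] gram by simp
  have sig: "\<sigma> = (K ** \<rho> \<beta> ** K) /\<^sub>R p" "p *\<^sub>R \<sigma> = K ** \<rho> \<beta> ** K"
    using p by (simp_all add: \<sigma>_def conditional_state_def K_def p_def)
  have psig: "psd \<sigma>"
  proof -
    have "\<sigma> = dagger (sqrt (inverse p) *\<^sub>R (R ** K)) ** (sqrt (inverse p) *\<^sub>R (R ** K))"
      using p by (simp add: sig(1) gram dagger_distribs mm_distribs)
    then show ?thesis by (metis psd_gram)
  qed
  define D' where "D' = (K ** D ** K) /\<^sub>R p - (q / p) *\<^sub>R \<sigma>"
  have der': "(conditional_state \<rho> P has_vector_derivative D') (at \<beta>)"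
    using conditional_state_has_derivative[OF der, of P] p
    by (simp add: D'_def K_def p_def \<sigma>_def q_def)
  \<comment> \<open>The conditional state may be singular, so solvability is a kernel condition:
    cancelling \<open>R\<close> shows that \<open>\<sigma> ** N = 0\<close> forces
    \<open>K ** N = 0\<close>, and every term of \<open>D' ** N\<close> then vanishes.\<close>
  have "\<exists>N. is_sld (conditional_state \<rho> P) \<beta> N"
  proof -
    have "hermitian D'"
      using psd_dagger[OF psig]
      by (simp add: hermitian_iff_dagger D'_def dagger_distribs dagger_mult K dD matrix_mul_assoc)
    moreover have "D' ** N = 0" if "\<sigma> ** N = 0" for N :: "'n cmat"
    proof -
      have "K ** \<rho> \<beta> ** K ** N = 0"
        using sig(2) that by (metis mm_distribs(7) scaleR_zero_right)
      then have "rtr (dagger (R ** K ** N) ** (R ** K ** N)) = 0"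
        by (simp add: gram dagger_mult matrix_mul_assoc)
          (simp add: rtr_distribs mm_zero flip: matrix_mul_assoc)
      then have "R ** (K ** N) = 0"
        unfolding rtr_gram_eq_0_iff by (simp only: matrix_mul_assoc)
      then have "K ** N = 0" by (rule R(3))
      then have "K ** D ** K ** N = 0"
        by (simp add: mm_zero flip: matrix_mul_assoc)
      then show ?thesis
        by (simp add: D'_def mm_distribs that)
    qed
    ultimately show ?thesis
      using anticommutator_equation[OF psig] der' unfolding is_sld_def \<sigma>_def by metis
  qed
  moreover define N where "N = (SOME N. is_sld (conditional_state \<rho> P) \<beta> N)"
  ultimately have N: "is_sld (conditional_state \<rho> P) \<beta> N"
    by (metis someI_ex)
  have qfi: "quantum_fisher_information (conditional_state \<rho> P) \<beta> = rtr (\<sigma> ** (N ** N))"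
    by (simp add: quantum_fisher_information_def N_def Let_def rtr_def \<sigma>_def)
  have dN: "dagger N = N" and eqN: "D' = (1/2) *\<^sub>R (\<sigma> ** N + N ** \<sigma>)"
    using N vector_derivative_unique_at[OF der']
    by (auto simp: is_sld_def hermitian_iff_dagger \<sigma>_def)
  have "rtr (\<sigma> ** (N ** N)) = rtr (N ** \<sigma> ** dagger N)"
    unfolding dN by (metis rtr_commute matrix_mul_assoc)
  then have qfi_nonneg: "quantum_fisher_information (conditional_state \<rho> P) \<beta> \<ge> 0"
    using psd_sandwich(1)[OF psig, of N] by (simp add: qfi)
  have tr1: "rtr \<sigma> = 1"
    using rtr_conditional_state[OF P(1)] p by (simp add: \<sigma>_def p_def)
  have "rtr (K ** D ** K) = q"
    unfolding q_def K(3)[symmetric] by (metis rtr_commute matrix_mul_assoc)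
  \<comment> \<open>The conditional state keeps trace one, so its derivative is traceless and
    \<open>N\<close> has mean zero.\<close>
  then have "rtr D' = 0"
    using p by (simp add: D'_def rtr_distribs tr1 divide_inverse)
  then have trN: "rtr (\<sigma> ** N) = 0"
    using rtr_anticommutator[of \<sigma> N "mat 1"] by (simp add: eqN)
  define c where "c = q / p"
  define M where "M = N + c *\<^sub>R mat 1"
  have "hermitian M"
    by (simp add: M_def hermitian_iff_dagger dagger_distribs dN)
      (simp add: dagger_def mat_def vec_eq_iff)
  moreover have "(1/2) *\<^sub>R ((K ** \<rho> \<beta> ** K) ** M + M ** (K ** \<rho> \<beta> ** K)) = K ** D ** K"
  proof -
    have "(1/2) *\<^sub>R (\<sigma> ** M + M ** \<sigma>) = (1/2) *\<^sub>R (\<sigma> ** N + N ** \<sigma>) + (1/2) *\<^sub>R (2 *\<^sub>R (c *\<^sub>R \<sigma>))"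
      by (simp add: M_def mm_distribs algebra_simps scaleR_2 del: scaleR_scaleR)
    also have "\<dots> = D' + c *\<^sub>R \<sigma>" by (simp add: eqN)
    also have "\<dots> = (K ** D ** K) /\<^sub>R p" by (simp add: D'_def c_def)
    finally have "p *\<^sub>R ((1/2) *\<^sub>R (\<sigma> ** M + M ** \<sigma>)) = p *\<^sub>R ((K ** D ** K) /\<^sub>R p)"
      by simp
    then show ?thesis
      unfolding sig(2)[symmetric] using p by (simp add: mm_distribs algebra_simps)
  qed
  moreover have "p * (deriv (\<lambda>b. ln (outcome_prob \<rho> P b)) \<beta>)\<^sup>2 +
      p * quantum_fisher_information (conditional_state \<rho> P) \<beta> = rtr ((K ** \<rho> \<beta> ** K) ** (M ** M))"
  proof -
    have "((\<lambda>b. ln (outcome_prob \<rho> P b)) has_real_derivative c) (at \<beta>)"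
      using outcome_prob_has_derivative[OF der, of P] p
      by (auto intro!: derivative_eq_intros simp: c_def q_def p_def)
    then have "deriv (\<lambda>b. ln (outcome_prob \<rho> P b)) \<beta> = c" by (rule DERIV_imp_deriv)
    moreover have "rtr (\<sigma> ** (M ** M)) = rtr (\<sigma> ** (N ** N)) + 2 * c * rtr (\<sigma> ** N) + c\<^sup>2 * rtr \<sigma>"
      by (simp add: M_def mm_distribs rtr_distribs power2_eq_square distrib_left)
    ultimately show ?thesis
      unfolding sig(2)[symmetric]
      by (simp add: mm_distribs rtr_distribs qfi trN tr1 algebra_simps)
  qed
  ultimately show ?thesis
    using that p qfi_nonneg unfolding D_def by blast
qed

section \<open>Summation over the outcomes\<close>

lemma povm_sum_information:
  assumes "povm X E"
  shows "((\<lambda>x. rtr (A ** E x)) has_sum rtr A) X"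
proof -
  have "linear (\<lambda>B. rtr (A ** B))"
    by (rule linearI) (simp_all add: mm_distribs rtr_distribs)
  then have "bounded_linear (\<lambda>B. rtr (A ** B))" by (simp add: linear_conv_bounded_linear)
  moreover have "(E has_sum mat 1) X" using assms by (simp add: povm_def)
  ultimately show ?thesis
    using has_sum_bounded_linear by fastforce
qed

section \<open>Information balance for models of full rank at \<open>\<beta>\<close>\<close>

context
  fixes \<rho> :: "real \<Rightarrow> 'n::finite cmat" and \<beta> :: real and L R :: "'n cmat"
  assumes sld: "is_sld \<rho> \<beta> L"
    and R: "hermitian R" "R ** R = \<rho> \<beta>" "\<And>N :: 'n cmat. R ** N = 0 \<Longrightarrow> N = 0"
begin

definition extracted :: "'n cmat \<Rightarrow> real" where
  "extracted P = outcome_prob \<rho> P \<beta> * (deriv (\<lambda>b. ln (outcome_prob \<rho> P b)) \<beta>)\<^sup>2"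

definition retained :: "'n cmat \<Rightarrow> real" where
  "retained P = outcome_prob \<rho> P \<beta> * quantum_fisher_information (conditional_state \<rho> P) \<beta>"

lemma psd_model: "psd (\<rho> \<beta>)"
  using psd_gram[of R] R by (simp add: hermitian_iff_dagger)

text \<open>The comparison of compressed informations with the root of \<open>P\<close> as
  \<open>K\<close>. For \<open>P = 0\<close> all terms vanish; commutation with \<open>L\<close>
  passes from \<open>P\<close> to its root and gives equality.\<close>

lemma outcome_information_bound:
  assumes P: "psd P"
  shows "0 \<le> extracted P" "0 \<le> retained P"
    and "extracted P + retained P \<le> rtr (L ** \<rho> \<beta> ** L ** P)"
    and "P ** L = L ** P \<Longrightarrow> extracted P + retained P = rtr (L ** \<rho> \<beta> ** L ** P)"
proof -
  have "0 \<le> extracted P \<and> 0 \<le> retained P \<and>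
      extracted P + retained P \<le> rtr (L ** \<rho> \<beta> ** L ** P) \<and>
      (P ** L = L ** P \<longrightarrow> extracted P + retained P = rtr (L ** \<rho> \<beta> ** L ** P))"
  proof (cases "P = 0")
    case True
    then have "outcome_prob \<rho> P \<beta> = 0"
      by (simp add: outcome_prob_def mm_zero rtr_distribs flip: rtr_def)
    then show ?thesis
      using True by (simp add: extracted_def retained_def mm_zero rtr_distribs)
  next
    case False
    define K where "K = psd_sqrt P"
    have K: "psd K" "K ** K = P"
      using psd_sqrt[OF P] by (auto simp: K_def)
    have L: "hermitian L" using sld by (simp add: is_sld_def)
    obtain M where M: "hermitian M"
      "(1/2) *\<^sub>R ((K ** \<rho> \<beta> ** K) ** M + M ** (K ** \<rho> \<beta> ** K)) =
        K ** ((1/2) *\<^sub>R (\<rho> \<beta> ** L + L ** \<rho> \<beta>)) ** K"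
      "extracted P + retained P = rtr ((K ** \<rho> \<beta> ** K) ** (M ** M))"
      and pos: "outcome_prob \<rho> P \<beta> > 0" "quantum_fisher_information (conditional_state \<rho> P) \<beta> \<ge> 0"
      using outcome_information[OF P False sld R] unfolding K_def extracted_def retained_def
      by metis
    have "extracted P + retained P \<le> rtr (L ** \<rho> \<beta> ** L ** P)"
      using compressed_information_le[OF psd_model _ L M(1,2)] K psd_def M(3) by metis
    moreover have "extracted P + retained P = rtr (L ** \<rho> \<beta> ** L ** P)" if "P ** L = L ** P"
      using compressed_information_eq[OF _ M(2)] commute_psd_root[OF L K(1)] that K(2) M(3)
      by metis
    ultimately show ?thesis
      using pos by (simp add: extracted_def retained_def)
  qed
  then show "0 \<le> extracted P" "0 \<le> retained P"
    and "extracted P + retained P \<le> rtr (L ** \<rho> \<beta> ** L ** P)"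
    and "P ** L = L ** P \<Longrightarrow> extracted P + retained P = rtr (L ** \<rho> \<beta> ** L ** P)"
    by blast+
qed

text \<open>Puts the information in the form obtained by summing the bounds of the single outcomes
  over a POVM.\<close>

lemma quantum_fisher_information_model: "quantum_fisher_information \<rho> \<beta> = rtr (L ** \<rho> \<beta> ** L)"
proof -
  define N where "N = (SOME N. is_sld \<rho> \<beta> N)"
  have "is_sld \<rho> \<beta> N"
    unfolding N_def using sld by (rule someI)
  then have "(1/2) *\<^sub>R (\<rho> \<beta> ** N + N ** \<rho> \<beta>) = (1/2) *\<^sub>R (\<rho> \<beta> ** L + L ** \<rho> \<beta>)"
    using sld unfolding is_sld_def by (blast intro: vector_derivative_unique_at)
  then have "rtr (\<rho> \<beta> ** (N ** N)) = rtr (\<rho> \<beta> ** (L ** L))"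
    by (rule anticommutator_solution_unique_square)
  moreover have "rtr (\<rho> \<beta> ** (L ** L)) = rtr (L ** \<rho> \<beta> ** L)"
    by (metis rtr_commute matrix_mul_assoc)
  ultimately show ?thesis
    by (simp add: quantum_fisher_information_def Let_def N_def flip: rtr_def)
qed

lemma disturbance_ge_fisher_information:
  assumes X: "povm X E"
  shows "fisher_information \<rho> X E \<beta> \<le> disturbance \<rho> X E \<beta>"
    and "(\<And>x. x \<in> X \<Longrightarrow> E x ** L = L ** E x) \<Longrightarrow>
      disturbance \<rho> X E \<beta> = fisher_information \<rho> X E \<beta>"
proof -
  let ?t = "\<lambda>x. rtr (L ** \<rho> \<beta> ** L ** E x)"
  have t: "(?t has_sum quantum_fisher_information \<rho> \<beta>) X"
    unfolding quantum_fisher_information_model by (rule povm_sum_information[OF X])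
  have psd: "psd (E x)" if "x \<in> X" for x
    using X that by (simp add: povm_def)
  note bnd = outcome_information_bound[OF psd]
  \<comment> \<open>\<open>infsum\<close> is zero for families that are not summable, so the sum can
    be split only after both parts are dominated by \<open>?t\<close>.\<close>
  have e: "(\<lambda>x. extracted (E x)) summable_on X" and r: "(\<lambda>x. retained (E x)) summable_on X"
    by (rule summable_on_comparison_test[OF has_sum_imp_summable[OF t]]; use bnd in fastforce)+
  have sum: "(\<Sum>\<^sub>\<infinity>x\<in>X. extracted (E x) + retained (E x)) =
      fisher_information \<rho> X E \<beta> + (quantum_fisher_information \<rho> \<beta> - disturbance \<rho> X E \<beta>)"
    unfolding infsum_add[OF e r]
    by (simp add: fisher_information_def disturbance_def extracted_def retained_def)
  have "(\<Sum>\<^sub>\<infinity>x\<in>X. extracted (E x) + retained (E x)) \<le> infsum ?t X"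
    using bnd by (intro infsum_mono summable_on_add e r has_sum_imp_summable[OF t])
  then show "fisher_information \<rho> X E \<beta> \<le> disturbance \<rho> X E \<beta>"
    using infsumI[OF t] sum by simp
  assume comm: "\<And>x. x \<in> X \<Longrightarrow> E x ** L = L ** E x"
  have "(\<Sum>\<^sub>\<infinity>x\<in>X. extracted (E x) + retained (E x)) = infsum ?t X"
    by (rule infsum_cong, rule bnd(4)[OF _ comm])
  then show "disturbance \<rho> X E \<beta> = fisher_information \<rho> X E \<beta>"
    using infsumI[OF t] sum by simp
qed

text \<open>Differentiating the commutation relation at \<open>\<beta>\<close> gives \<open>\<rho> ** (P ** L - L ** P) = 0\<close>.\<close>

lemma commutes_with_sld:
  assumes comm: "\<And>b. P ** \<rho> b = \<rho> b ** P" and L: "L ** \<rho> \<beta> = \<rho> \<beta> ** L"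
  shows "P ** L = L ** P"
proof -
  have der: "(\<rho> has_vector_derivative \<rho> \<beta> ** L) (at \<beta>)"
    using sld by (simp add: is_sld_def L flip: scaleR_2)
  note right = bounded_bilinear.bounded_linear_right[OF bounded_bilinear_matrix_mult, of P]
    and left = bounded_bilinear.bounded_linear_left[OF bounded_bilinear_matrix_mult, of P]
  note der2 = right[THEN bounded_linear.has_vector_derivative, OF der]
    left[THEN bounded_linear.has_vector_derivative, OF der]
  have "P ** (\<rho> \<beta> ** L) = (\<rho> \<beta> ** L) ** P"
    using vector_derivative_unique_at[OF der2(1)] der2(2) by (simp add: comm)
  \<comment> \<open>Cancelling \<open>R\<close> twice cancels the state.\<close>
  then have "R ** (R ** (P ** L - L ** P)) = 0"
    by (simp add: matrix_mul_assoc R(2) mm_distribs) (simp add: comm)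
  from R(3)[OF R(3)[OF this]] show ?thesis by simp
qed

end

theorem proposition3:
  fixes H :: "'n::finite cmat" and X :: "'x set" and E :: "'x \<Rightarrow> 'n cmat" and \<beta> :: real
  assumes "CARD('n) \<ge> 2"
    and "hermitian H"
    and "povm X E"
    and "semiclassical (thermal_state H) X E"
  shows "efficient TYPE('y) (thermal_state H) X E \<beta>"
proof -
  obtain L R :: "'n cmat" where sld: "is_sld (thermal_state H) \<beta> L"
    and L: "L ** thermal_state H \<beta> = thermal_state H \<beta> ** L"
    and R: "hermitian R" "R ** R = thermal_state H \<beta>" "\<And>N :: 'n cmat. R ** N = 0 \<Longrightarrow> N = 0"
    using thermal_state_sld[OF assms(2)] by blast
  have comm: "E x ** L = L ** E x" if "x \<in> X" for x
    using commutes_with_sld[OF sld R _ L] assms(4) that by (simp add: semiclassical_def)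
  have "disturbance (thermal_state H) X E \<beta> = fisher_information (thermal_state H) X E \<beta>"
    by (rule disturbance_ge_fisher_information(2)[OF sld R assms(3) comm])
  \<comment> \<open>A competitor with the same Fisher information has at least that value as
    disturbance, and the semiclassical scheme attains it.\<close>
  then show ?thesis
    unfolding efficient_def using disturbance_ge_fisher_information(1)[OF sld R] by metis
qed

end
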